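(* Let $\mathcal T$ be an ideal technology set with $(\mathbf x^{\min},\mathbf y^{\max})\notin\mathcal T$. Then the GS model over $\mathcal T$ with the GS range directions (for a fixed $\theta_{\min}\in[0,1)\cap\mathcal D$ common to all units) satisfies the strict monotonicity property (MO).
   Context: Data and technology. $\mathbf X=(x_{ij})\in\mathbb R^{m\times n}$ and $\mathbf Y=(y_{rj})\in\mathbb R^{s\times n}$ are input and output data matrices (no sign restriction). With $\mathbf e$ the vector of ones, the technology set is $\mathcal T=\{(\mathbf x,\mathbf y)\in\mathbb R^m\times\mathbb R^s:\ \mathbf X\boldsymbol\lambda\le\mathbf x,\ \mathbf Y\boldsymbol\lambda\ge\mathbf y \text{ for some } \boldsymbol\lambda\ge 0,\ \mathbf e^\top\boldsymbol\lambda=1\}$. Elements of $\mathcal T$ are called units. The ideal point of $\mathcal T$ is $(\mathbf x^{\min},\mathbf y^{\max})$ with $x_i^{\min}=\min_j x_{ij}$, $y_r^{\max}=\max_j y_{rj}$. Efficiency. $(\mathbf x_o,\mathbf y_o)\succnsim(\mathbf x_p,\mathbf y_p)$ (dominates) means $\mathbf x_o\le\mathbf x_p$, $\mathbf y_o\ge\mathbf y_p$ componentwise and the two points are distinct; strict domination means $\mathbf x_o<\mathbf x_p$, $\mathbf y_o>\mathbf y_p$ in every component. A unit of $\mathcal T$ is strongly efficient if no other unit of $\mathcal T$ dominates it, and weakly efficient if no unit of $\mathcal T$ strictly dominates it. The boundary $\partial\mathcal T$ is the set of weakly efficient units; $\partial^S\mathcal T$ is the set of strongly efficient units and $\partial^W\mathcal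 T=\partial\mathcal T\setminus\partial^S\mathcal T$. Ideal technology. $\mathcal T$ is an ideal technology set if every $(\mathbf x,\mathbf y)\in\partial^W\mathcal T$ has at least one component in common with the ideal point, i.e. $x_i=x_i^{\min}$ for some $i\in\{1,\dots,m\}$ or $y_r=y_r^{\max}$ for some $r\in\{1,\dots,s\}$. GS model. The real functions $\psi^x,\psi^y$ satisfy: (A1) $\operatorname{dom}\psi^x=(a^x,\infty)$, $\operatorname{dom}\psi^y=(a^y,\infty)$ with $a^x,a^y\in\{-\infty,0\}$; (A2) $\psi^x$ is smooth, concave, (strictly) increasing and $\psi^y$ is smooth, convex, (strictly) decreasing; (A3) $\psi^x(1)=\psi^y(1)=1$; (A4) $\operatorname{im}\psi^x=(b^x,\infty)$ with $b^x\in\{-\infty,0\}$ ($b^x=-\infty$ if the output directions $\mathbf g_o^y$ are zero for all units) and $\operatorname{im}\psi^y=(b^y,\infty)$ with $b^y\in\{-\infty,0\}$. Let $\mathcal D=\operatorname{dom}\psi^x\cap\operatorname{dom}\psi^y$. For a unit $(\mathbf x_o,\mathbf y_o)$ with direction $\mathbf g_o=(\mathbf g_o^x,\mathbf g_o^y)\ge0$, $\mathbf g_o\neq0$, its path is $\boldsymbol\phi_o(\theta)=(\boldsymbol\phi_o^x(\theta),\boldsymbol\phi_o^y(\theta))$, $\theta\in\mathcal D$, with $\boldsymbol\phi_o^x(\theta)=\mathbf x_o+(\psi^x(\theta)-1)\mathbf g_o^x$, $\boldsymbol\phi_o^y(\theta)=\mathbf y_o+(\psi^y(\theta)-1)\mathbf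 g_o^y$. The programme $(GS)_o$ is: minimise $\theta$ over $(\boldsymbol\lambda,\theta)$, $\theta\in\mathcal D$, subject to $\mathbf X\boldsymbol\lambda\le\boldsymbol\phi_o^x(\theta)$, $\mathbf Y\boldsymbol\lambda\ge\boldsymbol\phi_o^y(\theta)$, $\mathbf e^\top\boldsymbol\lambda=1$, $\boldsymbol\lambda\ge0$. It is part of the setting that the minimum is attained; its value $\theta_o^*\le1$ is the efficiency score of the unit. GS range directions. For fixed $\theta_{\min}\in[0,1)\cap\mathcal D$, the GS range direction of $(\mathbf x_o,\mathbf y_o)\in\mathcal T$ is $\mathbf g_o^x=\dfrac{\mathbf x_o-\mathbf x^{\min}}{1-\psi^x(\theta_{\min})}$, $\mathbf g_o^y=\dfrac{\mathbf y^{\max}-\mathbf y_o}{\psi^y(\theta_{\min})-1}$. (MO) Strict monotonicity: whenever $(\mathbf x_o,\mathbf y_o)\succnsim(\mathbf x_p,\mathbf y_p)$ for two units of $\mathcal T$, one has $\theta_o^*>\theta_p^*$. *)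

theory Defs
  imports "HOL-Analysis.Analysis"
begin

text \<open>The order on \<^typ>\<open>real^'n\<close> is componentwise for \<open>\<le>\<close>, but \<open><\<close> is only the
  strict part of \<open>\<le>\<close>; strict componentwise inequalities are therefore written out.\<close>

definition intensity :: "real^'n \<Rightarrow> bool" where
  "intensity l \<longleftrightarrow> 0 \<le> l \<and> (\<Sum>j\<in>UNIV. l $ j) = 1"

definition technology :: "real^'n^'m \<Rightarrow> real^'n^'s \<Rightarrow> ((real^'m) \<times> (real^'s)) set" where
  "technology X Y = {(x, y). \<exists>l. intensity l \<and> X *v l \<le> x \<and> y \<le> Y *v l}"

definition x_min :: "real^'n^'m \<Rightarrow> real^'m" where
  "x_min X = (\<chi> i. MIN j. X $ i $ j)"

definition y_max :: "real^'n^'s \<Rightarrow> real^'s" where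
  "y_max Y = (\<chi> r. MAX j. Y $ r $ j)"

definition dominates :: "(real^'m) \<times> (real^'s) \<Rightarrow> (real^'m) \<times> (real^'s) \<Rightarrow> bool" where
  "dominates u v \<longleftrightarrow> fst u \<le> fst v \<and> snd v \<le> snd u \<and> u \<noteq> v"

definition strictly_dominates :: "(real^'m) \<times> (real^'s) \<Rightarrow> (real^'m) \<times> (real^'s) \<Rightarrow> bool" where
  "strictly_dominates u v \<longleftrightarrow>
     (\<forall>i. fst u $ i < fst v $ i) \<and> (\<forall>r. snd v $ r < snd u $ r)"

definition strongly_efficient :: "((real^'m) \<times> (real^'s)) set \<Rightarrow> ((real^'m) \<times> (real^'s)) set" where
  "strongly_efficient T = {v \<in> T. \<not> (\<exists>u\<in>T. dominates u v)}"

definition weakly_efficient :: "((real^'m) \<times> (real^'s)) set \<Rightarrow> ((real^'m) \<times> (real^'s)) set" where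
  "weakly_efficient T = {v \<in> T. \<not> (\<exists>u\<in>T. strictly_dominates u v)}"

definition ideal_technology :: "real^'n^'m \<Rightarrow> real^'n^'s \<Rightarrow> bool" where
  "ideal_technology X Y \<longleftrightarrow>
     (\<forall>(x, y) \<in> weakly_efficient (technology X Y) - strongly_efficient (technology X Y).
        (\<exists>i. x $ i = x_min X $ i) \<or> (\<exists>r. y $ r = y_max Y $ r))"

text \<open>The open ray \<open>(a, \<infinity>)\<close> in the reals, with left end point possibly \<open>-\<infinity>\<close>.\<close>

definition ray :: "ereal \<Rightarrow> real set" where
  "ray a = {t. a < ereal t}"

text \<open>In the following, a direction map \<open>g\<close> assigns a direction to every unit, and \<open>D\<close> is
  the common domain of \<open>\<psi>x\<close> and \<open>\<psi>y\<close>.\<close>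

definition gs_path ::
  "(real \<Rightarrow> real) \<Rightarrow> (real \<Rightarrow> real) \<Rightarrow> ((real^'m) \<times> (real^'s) \<Rightarrow> (real^'m) \<times> (real^'s)) \<Rightarrow>
   (real^'m) \<times> (real^'s) \<Rightarrow> real \<Rightarrow> (real^'m) \<times> (real^'s)" where
  "gs_path \<psi>x \<psi>y g u \<theta> =
     (fst u + (\<psi>x \<theta> - 1) *\<^sub>R fst (g u), snd u + (\<psi>y \<theta> - 1) *\<^sub>R snd (g u))"

definition gs_feasible ::
  "real^'n^'m \<Rightarrow> real^'n^'s \<Rightarrow> real set \<Rightarrow> (real \<Rightarrow> real) \<Rightarrow> (real \<Rightarrow> real) \<Rightarrow>
   ((real^'m) \<times> (real^'s) \<Rightarrow> (real^'m) \<times> (real^'s)) \<Rightarrow> (real^'m) \<times> (real^'s) \<Rightarrow> real^'n \<Rightarrow> real \<Rightarrow> bool" where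
  "gs_feasible X Y D \<psi>x \<psi>y g u l \<theta> \<longleftrightarrow>
     \<theta> \<in> D \<and> intensity l \<and>
     X *v l \<le> fst (gs_path \<psi>x \<psi>y g u \<theta>) \<and> snd (gs_path \<psi>x \<psi>y g u \<theta>) \<le> Y *v l"

text \<open>The optimal value of the programme; meaningful when the minimum is attained.\<close>

definition gs_score ::
  "real^'n^'m \<Rightarrow> real^'n^'s \<Rightarrow> real set \<Rightarrow> (real \<Rightarrow> real) \<Rightarrow> (real \<Rightarrow> real) \<Rightarrow>
   ((real^'m) \<times> (real^'s) \<Rightarrow> (real^'m) \<times> (real^'s)) \<Rightarrow> (real^'m) \<times> (real^'s) \<Rightarrow> real" where
  "gs_score X Y D \<psi>x \<psi>y g u = (LEAST \<theta>. \<exists>l. gs_feasible X Y D \<psi>x \<psi>y g u l \<theta>)"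

definition range_direction ::
  "real^'n^'m \<Rightarrow> real^'n^'s \<Rightarrow> (real \<Rightarrow> real) \<Rightarrow> (real \<Rightarrow> real) \<Rightarrow> real \<Rightarrow>
   (real^'m) \<times> (real^'s) \<Rightarrow> (real^'m) \<times> (real^'s)" where
  "range_direction X Y \<psi>x \<psi>y \<theta>min u =
     ((fst u - x_min X) /\<^sub>R (1 - \<psi>x \<theta>min), (y_max Y - snd u) /\<^sub>R (\<psi>y \<theta>min - 1))"

definition strictly_monotone ::
  "((real^'m) \<times> (real^'s)) set \<Rightarrow> ((real^'m) \<times> (real^'s) \<Rightarrow> real) \<Rightarrow> bool" where
  "strictly_monotone T score \<longleftrightarrow> (\<forall>u\<in>T. \<forall>v\<in>T. dominates u v \<longrightarrow> score u > score v)"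

end

theory Submission
  imports Defs
begin

text \<open>Measured from the ideal point, with worsening counted positively, the technology is an
  upward closed polyhedron \<open>T\<close> in the nonnegative orthant that misses the origin, and the path
  of a unit scales its coordinates by factors rising from 0 at \<open>\<theta>min\<close> to 1 at \<open>\<theta> = 1\<close>.
  If \<open>u\<close> dominates \<open>v\<close>, then at the score of \<open>u\<close> the path of \<open>v\<close> is at a point \<open>w\<close> of \<open>T\<close>
  that is still dominated. Ideality of \<open>T\<close>, together with polyhedrality, allows all nonzero
  coordinates of \<open>w\<close> to be lowered slightly inside \<open>T\<close>; the path of \<open>v\<close> keeps its zero
  coordinates at zero, so it can be followed further and the score of \<open>v\<close> is smaller.\<close>

section \<open>Upward closed polyhedra: closedness and convexity\<close>

text \<open>The convex hull of the columns of \<open>P\<close> plus the nonnegative orthant.\<close>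

definition upper_polyhedron :: "real^'n^'k \<Rightarrow> (real^'k) set" where
  "upper_polyhedron P = {z. \<exists>l. intensity l \<and> P *v l \<le> z}"

lemma upper_polyhedron_upward:
  "z \<in> upper_polyhedron P \<Longrightarrow> z \<le> z' \<Longrightarrow> z' \<in> upper_polyhedron P"
  unfolding upper_polyhedron_def using order_trans by blast

lemma intensity_convex: "convex {l. intensity l}"
proof (rule convexI)
  fix l l' :: "real^'n" and a b :: real
  assume "l \<in> {l. intensity l}" "l' \<in> {l. intensity l}" "0 \<le> a" "0 \<le> b" "a + b = 1"
  then show "a *\<^sub>R l + b *\<^sub>R l' \<in> {l. intensity l}"
    by (simp add: intensity_def less_eq_vec_def sum.distrib sum_distrib_left[symmetric])
qed

lemma intensity_compact: "compact {l :: real^'n. intensity l}"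
proof -
  have "{l :: real^'n. intensity l} \<subseteq> cbox 0 1"
    unfolding intensity_def cbox_interval
  proof safe
    fix l :: "real^'n" assume l: "0 \<le> l" "(\<Sum>j\<in>UNIV. l $ j) = 1"
    have "l $ j \<le> 1" for j
      using member_le_sum[of j UNIV "\<lambda>j. l $ j"] l by (simp add: less_eq_vec_def)
    with l show "l \<in> {0..1}" by (simp add: less_eq_vec_def)
  qed
  moreover have "closed {l :: real^'n. intensity l}"
  proof -
    have "{l :: real^'n. intensity l} = (\<Inter>j. {l. 0 \<le> l $ j}) \<inter> {l. (\<Sum>j\<in>UNIV. l $ j) = 1}"
      by (auto simp: intensity_def less_eq_vec_def)
    then show ?thesis
      by (auto intro!: closed_INT closed_Int closed_Collect_le closed_Collect_eq continuous_intros)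
  qed
  ultimately show ?thesis
    by (meson bounded_cbox bounded_subset compact_eq_bounded_closed)
qed

text \<open>A point above \<open>P *v l\<close> is \<open>P *v l\<close> plus a nonnegative slack.
  The sum of a compact and a closed set has the form that \<open>compact_closed_sums\<close>
  expects.\<close>

lemma upper_polyhedron_sums:
  "upper_polyhedron P = (\<Union>x \<in> (*v) P ` {l. intensity l}. \<Union>y \<in> {0..}. {x + y})"
proof -
  have "(P *v l \<le> z) = (\<exists>y\<ge>0. z = P *v l + y)" for l z
    by (metis add.commute diff_add_cancel diff_ge_0_iff_ge le_add_same_cancel1)
  then show ?thesis by (auto simp: upper_polyhedron_def)
qed

lemma upper_polyhedron_closed: "closed (upper_polyhedron (P :: real^'n^'k))"
proof -
  have "compact ((*v) P ` {l. intensity l})"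
    by (intro compact_continuous_image intensity_compact matrix_vector_mult_linear_continuous_on)
  moreover have "closed {0 :: real^'k..}"
  proof -
    have "{0 :: real^'k..} = (\<Inter>i. {x. 0 \<le> x $ i})" by (auto simp: less_eq_vec_def)
    then show ?thesis
      by (auto intro!: closed_INT closed_Collect_le continuous_intros)
  qed
  ultimately show ?thesis
    unfolding upper_polyhedron_sums by (rule compact_closed_sums)
qed

lemma upper_polyhedron_convex: "convex (upper_polyhedron (P :: real^'n^'k))"
proof (rule convexI)
  fix z z' :: "real^'k" and a b :: real
  assume z: "z \<in> upper_polyhedron P" "z' \<in> upper_polyhedron P" and ab: "0 \<le> a" "0 \<le> b" "a + b = 1"
  then obtain l l' where l: "intensity l" "P *v l \<le> z" "intensity l'" "P *v l' \<le> z'"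
    by (auto simp: upper_polyhedron_def)
  have "intensity (a *\<^sub>R l + b *\<^sub>R l')"
    using convexD[OF intensity_convex] l ab by blast
  moreover have "P *v (a *\<^sub>R l + b *\<^sub>R l') \<le> a *\<^sub>R z + b *\<^sub>R z'"
    using l ab by (simp add: matrix_vector_right_distrib matrix_vector_mult_scaleR
        less_eq_vec_def add_mono mult_left_mono)
  ultimately show "a *\<^sub>R z + b *\<^sub>R z' \<in> upper_polyhedron P"
    by (auto simp: upper_polyhedron_def)
qed

section \<open>The cone of feasible directions at a point\<close>

text \<open>No closure is taken, so closedness has to be proved.\<close>

definition feasible_directions :: "'a::real_vector set \<Rightarrow> 'a \<Rightarrow> 'a set" where
  "feasible_directions T w = {c. \<exists>k>0. w + k *\<^sub>R c \<in> T}"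

lemma feasible_directions_step:
  assumes "convex T" "w \<in> T" "w + k *\<^sub>R c \<in> T" "0 \<le> h" "h \<le> k"
  shows "w + h *\<^sub>R c \<in> T"
proof (cases "k = 0")
  case False
  have "(1 - h / k) *\<^sub>R w + (h / k) *\<^sub>R (w + k *\<^sub>R c) \<in> T"
    using False assms by (intro convexD) auto
  moreover have "(1 - h / k) *\<^sub>R w + (h / k) *\<^sub>R (w + k *\<^sub>R c) = w + h *\<^sub>R c"
    using False by (simp add: algebra_simps)
  ultimately show ?thesis by simp
qed (use assms in auto)

text \<open>By convexity two feasible directions admit a common step \<open>h\<close>, and the
  midpoint of the two moved points is a step \<open>h/2\<close> along the sum. A positive factor on
  the direction is absorbed by the step length.\<close>

lemma feasible_directions_convex_cone:
  assumes T: "convex T" and w: "w \<in> T"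
  shows "convex_cone (feasible_directions T w)"
  unfolding convex_cone_iff
proof (intro conjI ballI allI impI)
  show "0 \<in> feasible_directions T w"
    using w by (auto simp: feasible_directions_def intro: exI[of _ 1])
next
  fix x y assume "x \<in> feasible_directions T w" "y \<in> feasible_directions T w"
  then obtain k k' where k: "k > 0" "w + k *\<^sub>R x \<in> T" "k' > 0" "w + k' *\<^sub>R y \<in> T"
    by (auto simp: feasible_directions_def)
  define h where "h = min k k'"
  have h: "h > 0" "w + h *\<^sub>R x \<in> T" "w + h *\<^sub>R y \<in> T"
    using k feasible_directions_step[OF T w] by (auto simp: h_def)
  have "(1/2) *\<^sub>R (w + h *\<^sub>R x) + (1/2) *\<^sub>R (w + h *\<^sub>R y) \<in> T"
    using h by (intro convexD[OF T]) auto
  moreover have "(1/2) *\<^sub>R (w + h *\<^sub>R x) + (1/2) *\<^sub>R (w + h *\<^sub>R y) = w + (h/2) *\<^sub>R (x + y)"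
    by (simp add: algebra_simps flip: scaleR_add_left)
  ultimately show "x + y \<in> feasible_directions T w"
    using h(1) by (auto simp: feasible_directions_def intro!: exI[of _ "h/2"])
next
  fix x and c :: real assume x: "x \<in> feasible_directions T w" and c: "0 \<le> c"
  then obtain k where k: "k > 0" "w + k *\<^sub>R x \<in> T"
    by (auto simp: feasible_directions_def)
  show "c *\<^sub>R x \<in> feasible_directions T w"
  proof (cases "c = 0")
    case True
    then show ?thesis using w by (auto simp: feasible_directions_def intro: exI[of _ 1])
  next
    case False
    then show ?thesis using k c by (auto simp: feasible_directions_def intro!: exI[of _ "k/c"])
  qed
qed

lemma convex_cone_sum:
  assumes "convex_cone C" "\<And>i. i \<in> I \<Longrightarrow> f i \<in> C"
  shows "sum f I \<in> C"
  using assms(2)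
  by (induction I rule: infinite_finite_induct)
    (auto intro: convex_cone_contains_0 convex_cone_add assms(1))

text \<open>Polyhedrality enters here: a finitely generated cone is closed, whereas the feasible
  directions of a general closed convex set need not form a closed cone.\<close>

lemma feasible_directions_upper_polyhedron:
  fixes P :: "real^'n^'k"
  assumes w: "w \<in> upper_polyhedron P"
  shows "feasible_directions (upper_polyhedron P) w =
    convex_cone hull (range (\<lambda>j. column j P - w) \<union> Basis)" (is "?F = convex_cone hull ?G")
proof
  show "convex_cone hull ?G \<subseteq> ?F"
  proof (rule hull_minimal)
    show "convex_cone ?F"
      using feasible_directions_convex_cone upper_polyhedron_convex w by blast
    have "column j P \<in> upper_polyhedron P" for j
    proof -
      have "intensity (axis j 1 :: real^'n)"
        by (auto simp: intensity_def less_eq_vec_def axis_def)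
      then show ?thesis
        by (auto simp: upper_polyhedron_def matrix_vector_mult_basis
            intro!: exI[of _ "axis j 1 :: real^'n"])
    qed
    moreover have "w + b \<in> upper_polyhedron P" if "b \<in> Basis" for b
      using that w by (intro upper_polyhedron_upward[OF w])
        (auto simp: Basis_vec_def less_eq_vec_def axis_def)
    ultimately show "?G \<subseteq> ?F"
      by (auto simp: feasible_directions_def intro!: exI[of _ 1])
  qed
next
  note C = convex_cone_convex_cone_hull[of ?G]
  show "?F \<subseteq> convex_cone hull ?G"
  proof
    fix c assume "c \<in> ?F"
    then obtain k l where k: "k > 0" and l: "intensity l" and le: "P *v l \<le> w + k *\<^sub>R c"
      by (auto simp: feasible_directions_def upper_polyhedron_def)
    \<comment> \<open>The slack \<open>e\<close> is nonnegative, hence a nonnegative combination of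
      the basis vectors. With it, \<open>k *\<^sub>R c\<close> splits as
      \<open>(P *v l - w) + e\<close>.\<close>
    define e where "e = w + k *\<^sub>R c - P *v l"
    have "0 \<le> e \<bullet> b" if "b \<in> Basis" for b
      using that le by (auto simp: e_def Basis_vec_def less_eq_vec_def inner_axis)
    then have "(\<Sum>b\<in>Basis. (e \<bullet> b) *\<^sub>R b) \<in> convex_cone hull ?G"
      by (intro convex_cone_sum[OF C] convex_cone_scaleR[OF C] hull_inc) auto
    then have e: "e \<in> convex_cone hull ?G"
      by (simp add: euclidean_representation)
    have "(\<Sum>j\<in>UNIV. l $ j *\<^sub>R (column j P - w)) \<in> convex_cone hull ?G"
      using l by (intro convex_cone_sum[OF C] convex_cone_scaleR[OF C] hull_inc)
        (auto simp: intensity_def less_eq_vec_def)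
    \<comment> \<open>The weights sum to 1, so \<open>w\<close> is subtracted exactly once.\<close>
    moreover have "(\<Sum>j\<in>UNIV. l $ j *\<^sub>R (column j P - w)) = P *v l - w"
      using l by (simp add: scaleR_diff_right sum_subtractf matrix_mult_sum intensity_def
          vector_scalar_mult_def scalar_mult_eq_scaleR flip: scaleR_sum_left)
    ultimately have "P *v l - w \<in> convex_cone hull ?G" by simp
    then have "(P *v l - w) + e \<in> convex_cone hull ?G"
      using e by (rule convex_cone_add[OF C])
    then have "k *\<^sub>R c \<in> convex_cone hull ?G" by (simp add: e_def)
    then have "(1/k) *\<^sub>R (k *\<^sub>R c) \<in> convex_cone hull ?G"
      using k by (intro convex_cone_scaleR[OF C, of "1/k"]) auto
    then show "c \<in> convex_cone hull ?G" using k by simp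
  qed
qed

lemma feasible_directions_closed:
  "w \<in> upper_polyhedron P \<Longrightarrow> closed (feasible_directions (upper_polyhedron P) w)"
  by (simp add: feasible_directions_upper_polyhedron closed_convex_cone_hull)

section \<open>Lowering the nonzero coordinates of a dominated point\<close>

text \<open>There are finitely many coordinates, so the smallest gap serves them all.\<close>

lemma strict_less_gap:
  fixes z z' :: "real^'k"
  assumes "\<forall>i. z' $ i < z $ i"
  obtains \<eta> where "\<eta> > 0" "\<And>i. z' $ i \<le> z $ i - \<eta>"
proof
  let ?\<eta> = "Min (range (\<lambda>i. z $ i - z' $ i))"
  show "?\<eta> > 0" using assms by (auto simp: Min_gr_iff)
  show "z' $ i \<le> z $ i - ?\<eta>" for i
  proof -
    have "?\<eta> \<le> z $ i - z' $ i" by (intro Min_le) auto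
    then show ?thesis by linarith
  qed
qed

text \<open>Let \<open>e\<close> be the indicator of the zero coordinates of \<open>w\<close> and \<open>p\<close> that of the
  others. Take the least \<open>s\<close> for which \<open>s e - p\<close> is a feasible direction at \<open>w\<close>; it
  exists because the cone of feasible directions is closed. If \<open>s > 0\<close>, the points just
  off \<open>w\<close> in this direction have no zero coordinate and are not strictly dominated, yet the
  midpoint of such a point with \<open>w'\<close> dominates the point half as far along.\<close>

lemma dominated_point_improvable:
  fixes T :: "(real^'k) set"
  assumes conv: "convex T"
    and up: "\<And>z z'. z \<in> T \<Longrightarrow> z \<le> z' \<Longrightarrow> z' \<in> T"
    and nonneg: "\<And>z. z \<in> T \<Longrightarrow> 0 \<le> z"
    and clos: "closed (feasible_directions T w)"
    and ideal: "\<And>z z'. z \<in> T \<Longrightarrow> z' \<in> T \<Longrightarrow> z' \<le> z \<Longrightarrow> z' \<noteq> z \<Longrightarrow> (\<forall>i. z $ i \<noteq> 0) \<Longrightarrow>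
                \<exists>z''\<in>T. \<forall>i. z'' $ i < z $ i"
    and w': "w' \<in> T" "w' \<le> w" "w' \<noteq> w"
  shows "\<exists>\<epsilon>>0. w - \<epsilon> *\<^sub>R (\<chi> i. if w $ i = 0 then 0 else 1) \<in> T"
proof -
  define p :: "real^'k" where "p = (\<chi> i. if w $ i = 0 then 0 else 1)"
  define e :: "real^'k" where "e = (\<chi> i. if w $ i = 0 then 1 else 0)"
  define S where "S = {s. s *\<^sub>R e - p \<in> feasible_directions T w}"
  have w: "w \<in> T" using up w' by blast
  have w0: "0 \<le> w $ i" for i using nonneg[OF w] by (simp add: less_eq_vec_def)
  \<comment> \<open>Adding \<open>e\<close> removes the zero coordinates while \<open>w'\<close>
    still lies below, so \<open>ideal\<close> applies to \<open>w + e\<close>. This shows that some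
    multiple of \<open>e\<close>, minus \<open>p\<close>, is a feasible direction.\<close>
  have we: "w \<le> w + e" by (simp add: e_def less_eq_vec_def)
  have "w' \<noteq> w + e" using w' we by auto
  moreover have "\<forall>i. (w + e) $ i \<noteq> 0" using w0 by (auto simp: e_def)
  ultimately obtain z where z: "z \<in> T" "\<forall>i. z $ i < (w + e) $ i"
    using ideal[of "w + e" w'] up[OF w we] w' we by (meson order_trans)
  obtain \<eta> where \<eta>: "\<eta> > 0" "\<And>i. z $ i \<le> (w + e) $ i - \<eta>"
    using strict_less_gap[OF z(2)] by metis
  \<comment> \<open>The coefficient makes a step of length \<open>\<eta>\<close> raise the zero
    coordinates to \<open>1 - \<eta>\<close> and lower the others by \<open>\<eta>\<close>.\<close>
  have "z $ i \<le> (w + \<eta> *\<^sub>R (((1 - \<eta>) / \<eta>) *\<^sub>R e - p)) $ i" for i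
    using \<eta>(1) \<eta>(2)[of i] by (auto simp: e_def p_def split: if_splits)
  then have "z \<le> w + \<eta> *\<^sub>R (((1 - \<eta>) / \<eta>) *\<^sub>R e - p)"
    by (simp add: less_eq_vec_def)
  then have S1: "(1 - \<eta>) / \<eta> \<in> S"
    using \<eta>(1) up[OF z(1)] by (auto simp: S_def feasible_directions_def)
  have "- p \<in> feasible_directions T w"
  proof (cases "\<exists>i. w $ i = 0")
    case False
    then have "e = 0" by (simp add: e_def vec_eq_iff)
    then show ?thesis using S1 by (simp add: S_def split: if_splits)
  next
    case True
    then obtain i0 where i0: "w $ i0 = 0" by blast
    \<comment> \<open>At the zero coordinate \<open>i0\<close> a step of length \<open>k\<close>
      leads to the value \<open>k * s\<close>, which must be nonnegative.\<close>
    have S0: "0 \<le> s" if s: "s \<in> S" for s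
    proof -
      obtain k where k: "k > 0" "w + k *\<^sub>R (s *\<^sub>R e - p) \<in> T"
        using s by (auto simp: S_def feasible_directions_def)
      then have "0 \<le> (w + k *\<^sub>R (s *\<^sub>R e - p)) $ i0"
        using nonneg[OF k(2)] by (simp add: less_eq_vec_def)
      then show ?thesis using k(1) i0 by (simp add: e_def p_def zero_le_mult_iff)
    qed
    have bdd: "bdd_below S" using S0 by (auto simp: bdd_below_def)
    have "closed ((\<lambda>s. s *\<^sub>R e - p) -` feasible_directions T w)"
      by (intro closed_vimage clos continuous_intros)
    then have "closed S" by (simp add: S_def vimage_def)
    then have inf: "Inf S \<in> S" using closed_contains_Inf bdd S1 by blast
    show ?thesis
    proof (cases "Inf S = 0")
      case True
      then show ?thesis using inf by (simp add: S_def)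
    next
      case False
      define s where "s = Inf S"
      have s: "s > 0" using False S0[OF inf] by (simp add: s_def)
      define q where "q = s *\<^sub>R e - p"
      obtain k where k: "k > 0" "w + k *\<^sub>R q \<in> T"
        using inf by (auto simp: S_def feasible_directions_def q_def s_def)
      \<comment> \<open>No nonzero coordinate of \<open>w\<close> is below \<open>h\<close>, so a
        step of length \<open>h/2\<close> keeps it at least \<open>h/2\<close>. The zero coordinates
        rise to \<open>s * h/2\<close>.\<close>
      define h where "h = Min (insert k {w $ i | i. w $ i \<noteq> 0})"
      have fin: "finite {w $ i | i. w $ i \<noteq> 0}"
        by (rule finite_subset[of _ "range (($) w)"]) auto
      have "w $ i > 0" if "w $ i \<noteq> 0" for i using that w0[of i] by simp
      then have h: "h > 0" "h \<le> k" "\<And>i. w $ i \<noteq> 0 \<Longrightarrow> h \<le> w $ i"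
        unfolding h_def using fin k(1) by (subst Min_gr_iff | intro Min_le | auto)+
      let ?z = "w + (h/2) *\<^sub>R q"
      have zT: "?z \<in> T" and hT: "w + h *\<^sub>R q \<in> T"
        using feasible_directions_step[OF conv w k(2)] h by auto
      have nz: "\<forall>i. ?z $ i \<noteq> 0"
      proof
        fix i show "?z $ i \<noteq> 0"
          using h(1) h(3)[of i] s by (auto simp: q_def e_def p_def)
      qed
      let ?z' = "(1/2) *\<^sub>R (w + h *\<^sub>R q) + (1/2) *\<^sub>R w'"
      have "?z' \<in> T" using hT w' by (intro convexD[OF conv]) auto
      moreover have diff: "?z - ?z' = (1/2) *\<^sub>R (w - w')"
        by (simp add: vec_eq_iff field_simps)
      have "?z' \<le> ?z"
      proof -
        have "0 \<le> ?z - ?z'" unfolding diff using w'(2) by (simp add: less_eq_vec_def)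
        then show ?thesis by simp
      qed
      moreover have "?z' \<noteq> ?z" using diff w'(3) by auto
      ultimately obtain v where v: "v \<in> T" "\<forall>i. v $ i < ?z $ i"
        using ideal[OF zT _ _ _ nz] by blast
      obtain \<delta> where \<delta>: "\<delta> > 0" "\<And>i. v $ i \<le> ?z $ i - \<delta>"
        using strict_less_gap[OF v(2)] by metis
      \<comment> \<open>On the zero coordinates of \<open>w\<close> the gain \<open>\<delta>\<close>
        reduces the coefficient of \<open>e\<close> by \<open>2 * \<delta> / h\<close>; on the
        others it is given away. The new coefficient lies in \<open>S\<close> below its infimum, a
        contradiction.\<close>
      have "v $ i \<le> (w + (h/2) *\<^sub>R ((s - 2 * \<delta> / h) *\<^sub>R e - p)) $ i" for i
        using \<delta>(1) \<delta>(2)[of i] h(1)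
        by (auto simp: q_def e_def p_def right_diff_distrib split: if_splits)
      then have "v \<le> w + (h/2) *\<^sub>R ((s - 2 * \<delta> / h) *\<^sub>R e - p)"
        by (simp add: less_eq_vec_def)
      then have "w + (h/2) *\<^sub>R ((s - 2 * \<delta> / h) *\<^sub>R e - p) \<in> T"
        using up v by blast
      then have "s - 2 * \<delta> / h \<in> S"
        using h(1) by (auto simp: S_def feasible_directions_def intro!: exI[of _ "h/2"])
      then have "s \<le> s - 2 * \<delta> / h" unfolding s_def using bdd by (intro cInf_lower)
      then show ?thesis using \<delta> h by (simp add: field_simps)
    qed
  qed
  then show ?thesis by (auto simp: feasible_directions_def p_def)
qed

section \<open>Damped paths and their least feasible parameter\<close>

definition damp :: "('k::finite \<Rightarrow> real) \<Rightarrow> real^'k \<Rightarrow> real^'k" where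
  "damp c u = (\<chi> k. c k * u $ k)"

lemma continuous_on_damp:
  assumes "\<And>k. continuous_on S (\<lambda>\<theta>. c \<theta> k)"
  shows "continuous_on S (\<lambda>\<theta>. damp (c \<theta>) u)"
  unfolding damp_def using assms by (intro continuous_intros) auto

text \<open>The GS programme in coordinates measured from the ideal point: \<open>a\<close> stands
  for \<open>\<theta>min\<close>, and \<open>c \<theta> k\<close> is the factor on coordinate
  \<open>k\<close> at parameter \<open>\<theta>\<close>. Every path is at the origin for parameter
  \<open>a\<close> and at its unit for parameter 1.\<close>

locale damped_paths =
  fixes T :: "(real^'k) set" and D :: "real set" and c :: "real \<Rightarrow> 'k \<Rightarrow> real" and a :: real
  assumes closed_T: "closed T"
    and up: "\<And>z z'. z \<in> T \<Longrightarrow> z \<le> z' \<Longrightarrow> z' \<in> T"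
    and nonneg: "\<And>z. z \<in> T \<Longrightarrow> 0 \<le> z"
    and zero: "0 \<notin> T"
    and a: "a < 1" "{a..1} \<subseteq> D"
    and cont: "\<And>k. continuous_on {a..1} (\<lambda>\<theta>. c \<theta> k)"
    and mono: "\<And>k. strict_mono_on D (\<lambda>\<theta>. c \<theta> k)"
    and ca: "\<And>k. c a k = 0"
    and c1: "\<And>k. c 1 k = 1"
begin

definition feas :: "real^'k \<Rightarrow> real \<Rightarrow> bool" where
  "feas u \<theta> \<longleftrightarrow> \<theta> \<in> D \<and> damp (c \<theta>) u \<in> T"

text \<open>Up to \<open>a\<close> all factors are nonpositive, so the path lies below the origin,
  and upward closedness would put the origin into \<open>T\<close>.\<close>

lemma feas_gt:
  assumes u: "u \<in> T" and f: "feas u \<theta>"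
  shows "a < \<theta>"
proof (rule ccontr)
  assume "\<not> a < \<theta>"
  then have "c \<theta> k \<le> 0" for k
    using strict_mono_onD[OF mono, of \<theta> a k] f a ca[of k]
    by (cases "\<theta> = a") (auto simp: feas_def order_less_le)
  then have "damp (c \<theta>) u \<le> 0"
    using nonneg[OF u] by (simp add: damp_def less_eq_vec_def mult_nonpos_nonneg)
  then show False using f up zero unfolding feas_def by blast
qed

text \<open>The feasible parameters in \<open>{a..1}\<close> form a compact set containing 1, so a
  least one exists. It is least among all feasible parameters because none is at or below
  \<open>a\<close>.\<close>

lemma feas_Least:
  assumes u: "u \<in> T"
  shows "feas u (LEAST \<theta>. feas u \<theta>)" "a < (LEAST \<theta>. feas u \<theta>)"
    "(LEAST \<theta>. feas u \<theta>) \<le> 1" "\<And>\<theta>. feas u \<theta> \<Longrightarrow> (LEAST \<theta>. feas u \<theta>) \<le> \<theta>"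
proof -
  let ?S = "{a..1} \<inter> (\<lambda>\<theta>. damp (c \<theta>) u) -` T"
  have "closed ?S"
    by (intro continuous_closed_preimage continuous_on_damp cont closed_T) auto
  then have "compact ?S"
    by (meson bounded_closed_interval bounded_subset compact_eq_bounded_closed inf_le1)
  moreover have f1: "feas u 1" using u a by (auto simp: feas_def damp_def c1)
  then have "1 \<in> ?S" using a by (auto simp: feas_def)
  ultimately obtain m where m: "m \<in> ?S" "\<And>\<theta>. \<theta> \<in> ?S \<Longrightarrow> m \<le> \<theta>"
    using compact_attains_inf[of ?S] by blast
  have fm: "feas u m" using m a by (auto simp: feas_def)
  have lm: "m \<le> \<theta>" if "feas u \<theta>" for \<theta>
    using m feas_gt[OF u that] that by (cases "\<theta> \<le> 1") (auto simp: feas_def)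
  have eq: "(LEAST \<theta>. feas u \<theta>) = m" using fm lm by (intro Least_equality)
  show "feas u (LEAST \<theta>. feas u \<theta>)" "a < (LEAST \<theta>. feas u \<theta>)"
    "(LEAST \<theta>. feas u \<theta>) \<le> 1" "\<And>\<theta>. feas u \<theta> \<Longrightarrow> (LEAST \<theta>. feas u \<theta>) \<le> \<theta>"
    unfolding eq using fm lm f1 feas_gt[OF u] by auto
qed

text \<open>At the least parameter of \<open>u\<close> the path of \<open>v\<close> is at a
  dominated point of \<open>T\<close>. By continuity, slightly earlier it is still above the lowered
  point supplied by \<open>improvable\<close>.\<close>

lemma Least_strict_mono:
  assumes improvable: "\<And>w w'. w' \<in> T \<Longrightarrow> w' \<le> w \<Longrightarrow> w' \<noteq> w \<Longrightarrow>
      \<exists>\<epsilon>>0. w - \<epsilon> *\<^sub>R (\<chi> i. if w $ i = 0 then 0 else 1) \<in> T"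
    and u: "u \<in> T" and uv: "u \<le> v" "u \<noteq> v"
  shows "(LEAST \<theta>. feas v \<theta>) < (LEAST \<theta>. feas u \<theta>)"
proof -
  define \<theta> where "\<theta> = (LEAST \<theta>. feas u \<theta>)"
  have \<theta>: "feas u \<theta>" "a < \<theta>" "\<theta> \<le> 1"
    using feas_Least[OF u] by (auto simp: \<theta>_def)
  have v: "v \<in> T" using up u uv by blast
  \<comment> \<open>Positive factors preserve both the order and the distinctness of
    \<open>u\<close> and \<open>v\<close>.\<close>
  have cpos: "0 < c \<theta> k" for k
    using strict_mono_onD[OF mono, of a \<theta> k] \<theta> a ca[of k]
    by (auto simp: feas_def subset_iff)
  define w where "w = damp (c \<theta>) v"
  have "damp (c \<theta>) u \<le> w"
    using uv(1) cpos by (auto simp: w_def damp_def less_eq_vec_def intro!: mult_left_mono less_imp_le)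
  moreover have "damp (c \<theta>) u \<noteq> w"
    using uv(2) cpos by (auto simp: w_def damp_def vec_eq_iff) (metis less_irrefl)
  ultimately obtain \<epsilon> where \<epsilon>: "\<epsilon> > 0" "w - \<epsilon> *\<^sub>R (\<chi> i. if w $ i = 0 then 0 else 1) \<in> T"
    using improvable[of "damp (c \<theta>) u" w] \<theta>(1) by (auto simp: feas_def)
  have "continuous_on {a..\<theta>} (\<lambda>t. damp (c t) v)"
    using \<theta> by (intro continuous_on_damp continuous_on_subset[OF cont]) auto
  then have "((\<lambda>t. damp (c t) v) \<longlongrightarrow> damp (c \<theta>) v) (at_left \<theta>)"
    using \<theta>(2) by (rule continuous_on_Icc_at_leftD)
  then have "((\<lambda>t. damp (c t) v $ i) \<longlongrightarrow> w $ i) (at_left \<theta>)" for i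
    unfolding w_def by (rule tendsto_vec_nth)
  then have "\<forall>\<^sub>F t in at_left \<theta>. w $ i - \<epsilon> < damp (c t) v $ i" for i
    by (rule order_tendstoD) (use \<epsilon> in simp)
  then have "\<forall>\<^sub>F t in at_left \<theta>. \<forall>i. w $ i - \<epsilon> < damp (c t) v $ i"
    by (simp add: eventually_all_finite)
  moreover have "\<forall>\<^sub>F t in at_left \<theta>. t \<in> {a<..<\<theta>}"
    using \<theta>(2) eventually_at_left_real by blast
  ultimately have "\<forall>\<^sub>F t in at_left \<theta>. (\<forall>i. w $ i - \<epsilon> < damp (c t) v $ i) \<and> t \<in> {a<..<\<theta>}"
    by eventually_elim auto
  then obtain t where t: "\<And>i. w $ i - \<epsilon> < damp (c t) v $ i" "a < t" "t < \<theta>"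
    by (auto dest!: eventually_happens'[OF trivial_limit_at_left_real])
  have "w - \<epsilon> *\<^sub>R (\<chi> i. if w $ i = 0 then 0 else 1) \<le> damp (c t) v"
    unfolding less_eq_vec_def
  proof
    fix i
    \<comment> \<open>Continuity gives only a bound lower by \<open>\<epsilon>\<close>, too weak
      where the lowered point is zero. There the path of \<open>v\<close> is constantly
      zero.\<close>
    have "w $ i = 0 \<Longrightarrow> v $ i = 0" using cpos[of i] by (simp add: w_def damp_def)
    then show "(w - \<epsilon> *\<^sub>R (\<chi> i. if w $ i = 0 then 0 else 1)) $ i \<le> damp (c t) v $ i"
      using t(1)[of i] by (auto simp: damp_def)
  qed
  then have "feas v t" using up[OF \<epsilon>(2)] t a \<theta> by (auto simp: feas_def)
  then have "(LEAST \<theta>. feas v \<theta>) \<le> t" by (rule feas_Least(4)[OF v])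
  then show ?thesis using t(3) by (simp add: \<theta>_def)
qed

end

section \<open>The technology in coordinates measured from the ideal point\<close>

text \<open>Reversing the sign of the outputs turns domination into the componentwise order on a
  single vector; the ideal point becomes the origin.\<close>

definition offset :: "real^'n^'m \<Rightarrow> real^'n^'s \<Rightarrow> (real^'m) \<times> (real^'s) \<Rightarrow> real^('m + 's)" where
  "offset X Y u =
     (\<chi> k. case k of Inl i \<Rightarrow> fst u $ i - x_min X $ i | Inr r \<Rightarrow> y_max Y $ r - snd u $ r)"

text \<open>The columns are the offsets of the observed units.\<close>

definition offset_matrix :: "real^'n^'m \<Rightarrow> real^'n^'s \<Rightarrow> real^'n^('m + 's)" where
  "offset_matrix X Y =
     (\<chi> k j. case k of Inl i \<Rightarrow> X $ i $ j - x_min X $ i | Inr r \<Rightarrow> y_max Y $ r - Y $ r $ j)"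

lemma offset_nth [simp]:
  "offset X Y u $ Inl i = fst u $ i - x_min X $ i"
  "offset X Y u $ Inr r = y_max Y $ r - snd u $ r"
  by (simp_all add: offset_def)

lemma offset_le_iff: "offset X Y u \<le> offset X Y v \<longleftrightarrow> fst u \<le> fst v \<and> snd v \<le> snd u"
  by (simp add: less_eq_vec_def split_sum_all)

lemma offset_eq_iff: "offset X Y u = offset X Y v \<longleftrightarrow> u = v"
  by (auto simp: vec_eq_iff split_sum_all prod_eq_iff)

lemma offset_surj: "\<exists>u. offset X Y u = z"
  by (rule exI[of _ "((\<chi> i. z $ Inl i + x_min X $ i), (\<chi> r. y_max Y $ r - z $ Inr r))"])
    (simp add: vec_eq_iff split_sum_all)

text \<open>Since the weights sum to 1, averaging commutes with subtracting the ideal point.\<close>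

lemma offset_matrix_mult:
  assumes "intensity l"
  shows "offset_matrix X Y *v l = offset X Y (X *v l, Y *v l)"
proof -
  have "(\<Sum>j\<in>UNIV. c * l $ j) = c" for c
    using assms by (simp add: intensity_def flip: sum_distrib_left)
  then show ?thesis
    by (simp add: vec_eq_iff split_sum_all matrix_vector_mult_def offset_matrix_def
        left_diff_distrib sum_subtractf)
qed

lemma technology_iff_offset:
  "u \<in> technology X Y \<longleftrightarrow> offset X Y u \<in> upper_polyhedron (offset_matrix X Y)"
  by (cases u) (auto simp: technology_def upper_polyhedron_def offset_matrix_mult offset_le_iff
      cong: conj_cong)

text \<open>The ideal point takes the best value over all columns, so every entry of the matrix is
  nonnegative.\<close>

lemma upper_polyhedron_offset_nonneg:
  assumes "z \<in> upper_polyhedron (offset_matrix X Y)"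
  shows "0 \<le> z"
proof -
  obtain l where l: "intensity l" "offset_matrix X Y *v l \<le> z"
    using assms by (auto simp: upper_polyhedron_def)
  have "0 \<le> offset_matrix X Y $ k $ j" for k j
    by (cases k) (auto simp: offset_matrix_def x_min_def y_max_def)
  then have "0 \<le> offset_matrix X Y *v l"
    using l(1) by (auto simp: less_eq_vec_def matrix_vector_mult_def intensity_def intro!: sum_nonneg)
  then show ?thesis using l(2) by (rule order_trans)
qed

text \<open>A nonzero offset in every coordinate means no component in common with the ideal point.
  A dominated unit of this kind is not strongly efficient, so ideality excludes weak efficiency
  too.\<close>

lemma ideal_technology_offset:
  assumes ideal: "ideal_technology X Y"
    and z: "z \<in> upper_polyhedron (offset_matrix X Y)"
    and z': "z' \<in> upper_polyhedron (offset_matrix X Y)" "z' \<le> z" "z' \<noteq> z"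
    and nz: "\<forall>k. z $ k \<noteq> 0"
  shows "\<exists>z''\<in>upper_polyhedron (offset_matrix X Y). \<forall>k. z'' $ k < z $ k"
proof -
  obtain u v where uv: "offset X Y u = z'" "offset X Y v = z"
    using offset_surj by meson
  have T: "u \<in> technology X Y" "v \<in> technology X Y"
    using uv z z' by (auto simp: technology_iff_offset)
  have "dominates u v"
    using uv z' by (auto simp: dominates_def offset_le_iff simp flip: offset_eq_iff)
  then have "v \<notin> strongly_efficient (technology X Y)"
    using T by (auto simp: strongly_efficient_def)
  moreover have "fst v $ i \<noteq> x_min X $ i" "snd v $ r \<noteq> y_max Y $ r" for i r
    using nz[rule_format, of "Inl i"] nz[rule_format, of "Inr r"] by (auto simp flip: uv)
  ultimately have "v \<notin> weakly_efficient (technology X Y)"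
    using ideal by (cases v) (force simp: ideal_technology_def)
  then obtain t where "t \<in> technology X Y" "strictly_dominates t v"
    using T by (auto simp: weakly_efficient_def)
  then show ?thesis
    by (intro bexI[of _ "offset X Y t"])
      (auto simp: strictly_dominates_def split_sum_all technology_iff_offset simp flip: uv)
qed

section \<open>The GS programme with range directions\<close>

text \<open>The range direction is a multiple of the offset in the inputs and in the outputs, so
  moving along it only rescales: for inputs the factor is
  \<open>1 + (\<psi>x \<theta> - 1) / (1 - \<psi>x \<theta>min)\<close>.\<close>

lemma offset_range_path:
  assumes "\<psi>x \<theta>min \<noteq> 1" "\<psi>y \<theta>min \<noteq> 1"
  shows "offset X Y (gs_path \<psi>x \<psi>y (range_direction X Y \<psi>x \<psi>y \<theta>min) u \<theta>) =
    damp (case_sum (\<lambda>_. (\<psi>x \<theta> - \<psi>x \<theta>min) / (1 - \<psi>x \<theta>min))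
                   (\<lambda>_. (\<psi>y \<theta>min - \<psi>y \<theta>) / (\<psi>y \<theta>min - 1))) (offset X Y u)"
  using assms
  by (simp add: vec_eq_iff split_sum_all damp_def gs_path_def range_direction_def divide_simps)
    (simp add: algebra_simps)

lemma gs_feasible_iff_technology:
  "(\<exists>l. gs_feasible X Y D \<psi>x \<psi>y g u l \<theta>) \<longleftrightarrow> \<theta> \<in> D \<and> gs_path \<psi>x \<psi>y g u \<theta> \<in> technology X Y"
  by (cases "gs_path \<psi>x \<psi>y g u \<theta>") (auto simp: gs_feasible_def technology_def)

theorem theorem4p10:
  fixes X :: "real^'n^'m" and Y :: "real^'n^'s"
    and \<psi>x \<psi>y :: "real \<Rightarrow> real" and a_x a_y b_x b_y :: ereal and \<theta>min :: real
  defines "T \<equiv> technology X Y"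
    and "D \<equiv> ray a_x \<inter> ray a_y"
    and "g \<equiv> range_direction X Y \<psi>x \<psi>y \<theta>min"
  assumes A1: "a_x \<in> {-\<infinity>, 0}" "a_y \<in> {-\<infinity>, 0}"
    and A2x: "\<psi>x C1_differentiable_on ray a_x" "concave_on (ray a_x) \<psi>x" "strict_mono_on (ray a_x) \<psi>x"
    and A2y: "\<psi>y C1_differentiable_on ray a_y" "convex_on (ray a_y) \<psi>y" "strict_antimono_on (ray a_y) \<psi>y"
    and A3: "\<psi>x 1 = 1" "\<psi>y 1 = 1"
    and A4x: "b_x \<in> {-\<infinity>, 0}" "\<psi>x ` ray a_x = ray b_x" "(\<forall>u\<in>T. snd (g u) = 0) \<longrightarrow> b_x = -\<infinity>"
    and A4y: "b_y \<in> {-\<infinity>, 0}" "\<psi>y ` ray a_y = ray b_y"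
    and theta_min: "\<theta>min \<in> {0..<1} \<inter> D"
    and ideal: "ideal_technology X Y"
    and ideal_point: "(x_min X, y_max Y) \<notin> T"
  shows "strictly_monotone T (gs_score X Y D \<psi>x \<psi>y g)"
proof -
  let ?P = "offset_matrix X Y"
  define c :: "real \<Rightarrow> 'm + 's \<Rightarrow> real" where
    "c \<theta> = case_sum (\<lambda>_. (\<psi>x \<theta> - \<psi>x \<theta>min) / (1 - \<psi>x \<theta>min))
                    (\<lambda>_. (\<psi>y \<theta>min - \<psi>y \<theta>) / (\<psi>y \<theta>min - 1))" for \<theta>
  have D1: "{\<theta>min..1} \<subseteq> ray a_x" "{\<theta>min..1} \<subseteq> ray a_y" and lt: "\<theta>min < 1"
    using theta_min by (auto simp: D_def ray_def intro: less_le_trans)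
  \<comment> \<open>Together with the bound on \<open>\<psi>y\<close> this makes both denominators
    in \<open>c\<close> positive.\<close>
  have \<psi>x: "\<psi>x \<theta>min < 1"
    using strict_mono_onD[OF A2x(3), of \<theta>min 1] D1 lt A3 by (auto simp: subset_iff)
  have \<psi>y: "1 < \<psi>y \<theta>min"
    using monotone_onD[OF A2y(3), of \<theta>min 1] D1 lt A3 by (auto simp: subset_iff)
  interpret damped_paths "upper_polyhedron ?P" D c \<theta>min
  proof
    show "closed (upper_polyhedron ?P)" by (rule upper_polyhedron_closed)
    show "z' \<in> upper_polyhedron ?P" if "z \<in> upper_polyhedron ?P" "z \<le> z'" for z z'
      using that by (rule upper_polyhedron_upward)
    show "0 \<le> z" if "z \<in> upper_polyhedron ?P" for z
      using that by (rule upper_polyhedron_offset_nonneg)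
    have "offset X Y (x_min X, y_max Y) = 0"
      by (simp add: vec_eq_iff split_sum_all)
    then show "0 \<notin> upper_polyhedron ?P"
      using ideal_point by (simp add: T_def technology_iff_offset)
    show "\<theta>min < 1" "{\<theta>min..1} \<subseteq> D" using lt D1 by (auto simp: D_def)
    fix k
    have "continuous_on {\<theta>min..1} \<psi>x" "continuous_on {\<theta>min..1} \<psi>y"
      using C1_differentiable_imp_continuous_on A2x(1) A2y(1) D1 continuous_on_subset by blast+
    then show "continuous_on {\<theta>min..1} (\<lambda>\<theta>. c \<theta> k)"
      using \<psi>x \<psi>y by (cases k) (auto simp: c_def intro!: continuous_intros)
    show "strict_mono_on D (\<lambda>\<theta>. c \<theta> k)"
    proof (rule strict_mono_onI)
      fix r s assume "r \<in> D" "s \<in> D" "r < s"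
      then have "\<psi>x r < \<psi>x s" "\<psi>y s < \<psi>y r"
        using strict_mono_onD[OF A2x(3)] monotone_onD[OF A2y(3)] by (auto simp: D_def)
      then show "c r k < c s k"
        using \<psi>x \<psi>y by (cases k) (auto simp: c_def divide_strict_right_mono)
    qed
    show "c \<theta>min k = 0" "c 1 k = 1"
      using \<psi>x \<psi>y A3 by (cases k; simp add: c_def)+
  qed
  \<comment> \<open>The score is the least feasible parameter of a damped path, so attainment of the
    minimum follows from \<open>feas_Least\<close>.\<close>
  have score: "gs_score X Y D \<psi>x \<psi>y g u = (LEAST \<theta>. feas (offset X Y u) \<theta>)" for u
    using \<psi>x \<psi>y
    by (simp add: gs_score_def gs_feasible_iff_technology technology_iff_offset g_def
        offset_range_path feas_def c_def)
  show ?thesis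
    unfolding strictly_monotone_def
  proof (intro ballI impI)
    fix u v assume "u \<in> T" "v \<in> T" and dom: "dominates u v"
    then have u: "offset X Y u \<in> upper_polyhedron ?P"
      by (simp add: T_def technology_iff_offset)
    have le: "offset X Y u \<le> offset X Y v" "offset X Y u \<noteq> offset X Y v"
      using dom by (auto simp: dominates_def offset_le_iff offset_eq_iff)
    have "(LEAST \<theta>. feas (offset X Y v) \<theta>) < (LEAST \<theta>. feas (offset X Y u) \<theta>)"
    proof (rule Least_strict_mono[OF _ u le])
      fix w w' assume w': "w' \<in> upper_polyhedron ?P" "w' \<le> w" "w' \<noteq> w"
      then have "w \<in> upper_polyhedron ?P" by (blast intro: up)
      then show "\<exists>\<epsilon>>0. w - \<epsilon> *\<^sub>R (\<chi> i. if w $ i = 0 then 0 else 1) \<in> upper_polyhedron ?P"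
        by (intro dominated_point_improvable[OF upper_polyhedron_convex up nonneg
              feasible_directions_closed ideal_technology_offset[OF ideal] w'])
    qed
    then show "gs_score X Y D \<psi>x \<psi>y g v < gs_score X Y D \<psi>x \<psi>y g u"
      by (simp add: score)
  qed
qed

end
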